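(* Every inner metric space $X$ is coverable. Moreover, $\widetilde{X}=\varprojlim X_{\varepsilon_i}$, where $(\varepsilon_i)$ is any sequence of positive values decreasing to $0$.
   Context: An inner metric space is a metric space such that the distance between any two points is the infimum of the lengths of curves joining them. Metric spaces carry their metric uniformity; $E_\varepsilon=\{(x,y):d(x,y)<\varepsilon\}$ is the metric entourage of size $\varepsilon$ and $X_\varepsilon$ denotes $X_{E_\varepsilon}$. All entourages are taken to be symmetric. Fix a basepoint $*\in X$. For an entourage $E$ of $X$, an $E$-chain from $p$ to $q$ is a finite sequence $\{x_0=p,\dots,x_n=q\}$ with $(x_i,x_{i+1})\in E$ for all $i$. Two $E$-chains with the same endpoints are $E$-homotopic if one is obtained from the other in finitely many steps, each adding or removing a single point, always keeping the endpoints fixed and keeping an $E$-chain at each stage (in particular $\{p\}$ and $\{p,p\}$ are $E$-homotopic); $[\alpha]_E$ is the class of $\alpha$. $X_E$ is the set of $E$-homotopy classes of $E$-chains starting at $*$. For an entourage $D\subset E$ let $D^*$ be the set of pairs $([*=x_0,\dots,x_n,y]_E,[*=x_0,\dots,x_n,z]_E)$ with $(y,z)\in D$; $X_E$ carries the uniformity with base $\{D^*:D\subset E\}$. For $D\subset E$, $\phi_{ED}:X_D\to X_E$ is $[\alpha]_D\mapsto[\alpha]_E$. $\widetilde{X}=\varprojlim X_E$ (over all entourages, ordered by reverse inclusion, with bonding maps $\phi_{ED}$ and the inverse limit uniformity), with projections $\phi_E:\widetilde{X}\to X_E$. The bonding maps of the sequence $(X_{\varepsilon_i})$ are $\phi_{E_{\varepsilon_i}E_{\varepsilon_j}}$,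 $j\ge i$, and the equality $\widetilde{X}=\varprojlim X_{\varepsilon_i}$ is via the natural identification (uniform homeomorphism). $X$ is coverable if its uniformity has a base, containing $X\times X$, of entourages $E$ for which $\phi_E$ is surjective. *)

theory Defs
  imports "HOL-Analysis.Analysis"
begin

section \<open>Inner metric spaces\<close>

text \<open>The curve is parametrised on the unit interval; its length may be infinite.\<close>

definition curve_length :: "(real \<Rightarrow> 'a::metric_space) \<Rightarrow> ennreal" where
  "curve_length g =
     (SUP (n, t) \<in> {(n :: nat, t :: nat \<Rightarrow> real). mono_on {..n} t \<and> t 0 = 0 \<and> t n = 1}.
        \<Sum>i<n. ennreal (dist (g (t i)) (g (t (Suc i)))))"

text \<open>If no curve joins two points, the infimum is infinite and the condition fails; so an inner
  metric space is in particular path connected.\<close>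

definition inner_metric_space :: "'a::metric_space itself \<Rightarrow> bool" where
  "inner_metric_space _ \<longleftrightarrow>
     (\<forall>x y :: 'a. ennreal (dist x y) =
        (INF g \<in> {g. path g \<and> pathstart g = x \<and> pathfinish g = y}. curve_length g))"


section \<open>Chains and their homotopies\<close>

definition entourage :: "('a::uniform_space \<times> 'a) set \<Rightarrow> bool" where
  "entourage E \<longleftrightarrow> eventually (\<lambda>p. p \<in> E) uniformity \<and> sym E"

definition metric_entourage :: "real \<Rightarrow> ('a::metric_space \<times> 'a) set" where
  "metric_entourage \<epsilon> = {(x, y). dist x y < \<epsilon>}"

definition echain :: "('a \<times> 'a) set \<Rightarrow> 'a \<Rightarrow> 'a \<Rightarrow> 'a list \<Rightarrow> bool" where
  "echain E p q c \<longleftrightarrow>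
     c \<noteq> [] \<and> hd c = p \<and> last c = q \<and> successively (\<lambda>x y. (x, y) \<in> E) c"

definition insert_point :: "('a \<times> 'a) set \<Rightarrow> 'a list \<Rightarrow> 'a list \<Rightarrow> bool" where
  "insert_point E c c' \<longleftrightarrow>
     (\<exists>p q. echain E p q c \<and> echain E p q c') \<and> (\<exists>us x vs. c = us @ vs \<and> c' = us @ x # vs)"

definition homotopy_class :: "('a \<times> 'a) set \<Rightarrow> 'a list \<Rightarrow> 'a list set" where
  "homotopy_class E c = {c'. equivclp (insert_point E) c c'}"

definition chain_space :: "'a \<Rightarrow> ('a \<times> 'a) set \<Rightarrow> 'a list set set" where
  "chain_space pt E = {homotopy_class E c |c q. echain E pt q c}"

definition star_entourage ::
  "'a \<Rightarrow> ('a \<times> 'a) set \<Rightarrow> ('a \<times> 'a) set \<Rightarrow> ('a list set \<times> 'a list set) set" where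
  "star_entourage pt E D =
     {(homotopy_class E (xs @ [y]), homotopy_class E (xs @ [z])) |xs y z.
        xs \<noteq> [] \<and> echain E pt y (xs @ [y]) \<and> echain E pt z (xs @ [z]) \<and> (y, z) \<in> D}"

text \<open>A uniformity on a carrier \<open>S\<close> is represented as a filter on pairs that contains \<open>S \<times> S\<close>;
  its entourages are the sets of pairs that belong to the filter.\<close>

definition chain_uniformity ::
  "'a::uniform_space \<Rightarrow> ('a \<times> 'a) set \<Rightarrow> ('a list set \<times> 'a list set) filter" where
  "chain_uniformity pt E =
     (INF D \<in> {D. entourage D \<and> D \<subseteq> E}. principal (star_entourage pt E D))"

lemma eventually_chain_uniformity:
  assumes "entourage E"
  shows "eventually P (chain_uniformity pt E) \<longleftrightarrow>
    (\<exists>D. entourage D \<and> D \<subseteq> E \<and> (\<forall>p \<in> star_entourage pt E D. P p))"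
proof -
  have "\<exists>D \<in> {D. entourage D \<and> D \<subseteq> E}. principal (star_entourage pt E D) \<le>
      inf (principal (star_entourage pt E D1)) (principal (star_entourage pt E D2))"
    if "entourage D1 \<and> D1 \<subseteq> E" "entourage D2 \<and> D2 \<subseteq> E" for D1 D2
    using that
    by (intro bexI[of _ "D1 \<inter> D2"])
       (auto simp: star_entourage_def entourage_def eventually_conj_iff sym_Int)
  then show ?thesis
    unfolding chain_uniformity_def using assms
    by (subst eventually_INF_base) (auto simp: eventually_principal)
qed

text \<open>For \<open>D \<subseteq> E\<close> this is the map from \<open>D\<close>-classes to \<open>E\<close>-classes; see the lemma below.\<close>

definition chain_map :: "('a \<times> 'a) set \<Rightarrow> 'a list set \<Rightarrow> 'a list set" where
  "chain_map E C = (\<Union>c\<in>C. homotopy_class E c)"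

lemma chain_map_homotopy_class:
  assumes "D \<subseteq> E"
  shows "chain_map E (homotopy_class D c) = homotopy_class E c"
proof -
  have echain: "echain D p q c \<Longrightarrow> echain E p q c" for p q c
    using assms by (auto simp: echain_def elim: successively_mono)
  have step: "symclp (insert_point D) a b \<Longrightarrow> symclp (insert_point E) a b" for a b
    unfolding symclp_def insert_point_def using echain by blast
  have le: "equivclp (insert_point E) a b" if "equivclp (insert_point D) a b" for a b
    using that unfolding equivclp_def by (rule rtranclp_mono[THEN predicate2D, rotated]) (use step in blast)
  have "equivclp (insert_point E) c b"
    if "equivclp (insert_point D) c a" "equivclp (insert_point E) a b" for a b
    using equivclp_trans[OF le[OF that(1)] that(2)] .
  moreover have "equivclp (insert_point D) c c" by simp
  ultimately show ?thesis
    unfolding chain_map_def homotopy_class_def by blast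
qed


section \<open>Inverse limits of uniform spaces\<close>

definition inverse_limit ::
  "'i set \<Rightarrow> ('i \<Rightarrow> 'i \<Rightarrow> bool) \<Rightarrow> ('i \<Rightarrow> 'b set) \<Rightarrow> ('i \<Rightarrow> 'i \<Rightarrow> 'b \<Rightarrow> 'b) \<Rightarrow> ('i \<Rightarrow> 'b) set" where
  "inverse_limit I le S \<phi> =
     {f \<in> (\<Pi>\<^sub>E i\<in>I. S i). \<forall>i\<in>I. \<forall>j\<in>I. le i j \<longrightarrow> \<phi> i j (f j) = f i}"

definition inverse_limit_uniformity ::
  "'i set \<Rightarrow> ('i \<Rightarrow> 'b) set \<Rightarrow> ('i \<Rightarrow> ('b \<times> 'b) filter) \<Rightarrow> (('i \<Rightarrow> 'b) \<times> ('i \<Rightarrow> 'b)) filter" where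
  "inverse_limit_uniformity I L U =
     inf (principal (L \<times> L)) (INF i\<in>I. filtercomap (\<lambda>(f, g). (f i, g i)) (U i))"

definition uniform_homeomorphism ::
  "'b set \<Rightarrow> ('b \<times> 'b) filter \<Rightarrow> 'c set \<Rightarrow> ('c \<times> 'c) filter \<Rightarrow> ('b \<Rightarrow> 'c) \<Rightarrow> bool" where
  "uniform_homeomorphism A U B V f \<longleftrightarrow>
     bij_betw f A B \<and>
     filterlim (map_prod f f) V U \<and>
     filterlim (map_prod (inv_into A f) (inv_into A f)) U V"


section \<open>The limit over all entourages, and coverability\<close>

definition limit_space ::
  "'a::uniform_space \<Rightarrow> (('a \<times> 'a) set \<Rightarrow> 'a list set) set" where
  "limit_space pt =
     inverse_limit {E. entourage E} (\<lambda>E D. D \<subseteq> E) (chain_space pt) (\<lambda>E D. chain_map E)"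

definition limit_uniformity ::
  "'a::uniform_space \<Rightarrow>
     ((('a \<times> 'a) set \<Rightarrow> 'a list set) \<times> (('a \<times> 'a) set \<Rightarrow> 'a list set)) filter" where
  "limit_uniformity pt =
     inverse_limit_uniformity {E. entourage E} (limit_space pt) (chain_uniformity pt)"

definition coverable :: "'a::uniform_space \<Rightarrow> bool" where
  "coverable pt \<longleftrightarrow>
     (\<exists>B. UNIV \<in> B \<and>
        (\<forall>E\<in>B. entourage E \<and> (\<lambda>f. f E) ` limit_space pt = chain_space pt E) \<and>
        (\<forall>F :: ('a \<times> 'a) set. eventually (\<lambda>p. p \<in> F) uniformity \<longrightarrow> (\<exists>E\<in>B. E \<subseteq> F)))"

definition seq_limit_space ::
  "'a::metric_space \<Rightarrow> (nat \<Rightarrow> real) \<Rightarrow> (nat \<Rightarrow> 'a list set) set" where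
  "seq_limit_space pt \<epsilon> =
     inverse_limit UNIV (\<le>) (\<lambda>i. chain_space pt (metric_entourage (\<epsilon> i)))
       (\<lambda>i j. chain_map (metric_entourage (\<epsilon> i)))"

definition seq_limit_uniformity ::
  "'a::metric_space \<Rightarrow> (nat \<Rightarrow> real) \<Rightarrow>
     ((nat \<Rightarrow> 'a list set) \<times> (nat \<Rightarrow> 'a list set)) filter" where
  "seq_limit_uniformity pt \<epsilon> =
     inverse_limit_uniformity UNIV (seq_limit_space pt \<epsilon>)
       (\<lambda>i. chain_uniformity pt (metric_entourage (\<epsilon> i)))"

end

theory Submission
  imports Defs
begin

text \<open>
  In an inner metric space any two points at distance less than \<open>e\<close> have an approximate
  midpoint, at distance less than \<open>e / 2\<close> from both
  (\<open>inner_metric_space_midpoint\<close>). Inserting approximate midpoints into all steps of an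
  \<open>E\<^sub>e\<close>-chain gives a chain at scale \<open>e / 2\<close>, and every single
  insertion is an elementary \<open>E\<^sub>e\<close>-homotopy
  (\<open>echain_homotopic_finer\<close>). Therefore the bonding map from \<open>X\<close> at scale
  \<open>e / 2\<close> to \<open>X\<close> at scale \<open>e\<close> is surjective. Lifting a class
  successively along the scales \<open>e, e / 2, e / 4, \<dots>\<close> shows that the limit of this
  sequence maps onto its first term (\<open>limit_space_eval_surj\<close>).

  The entourages of a decreasing sequence that is a base of the uniformity are cofinal among all
  entourages. So a thread of the sequence extends uniquely to a thread over all entourages, by
  pushing it forward along bonding maps, and as these are uniformly continuous, the bijection is a
  uniform homeomorphism (\<open>uniform_homeomorphism_restriction\<close>). For the metric
  entourages of sizes \<open>\<epsilon>\<^sub>i\<close> this is the second claim. With the scales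
  \<open>e / 2\<^sup>i\<close> it turns the previous paragraph into the surjectivity of the
  projection to \<open>X\<close> at scale \<open>e\<close>. The metric entourages form a base, to
  which only \<open>X \<times> X\<close> has to be added; its projection is surjective because a
  finite chain is an \<open>E\<^sub>e\<close>-chain for some large \<open>e\<close>.
\<close>

section \<open>Chains and chain homotopies\<close>

lemma echain_mono: "echain D p q c \<Longrightarrow> D \<subseteq> E \<Longrightarrow> echain E p q c"
  by (auto simp: echain_def elim: successively_mono)

lemma homotopy_class_eq_iff:
  "homotopy_class E c = homotopy_class E c' \<longleftrightarrow> equivclp (insert_point E) c c'"
proof
  assume "homotopy_class E c = homotopy_class E c'"
  then have "c' \<in> homotopy_class E c" by (simp add: homotopy_class_def)
  then show "equivclp (insert_point E) c c'" by (simp add: homotopy_class_def)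
next
  assume "equivclp (insert_point E) c c'"
  then show "homotopy_class E c = homotopy_class E c'"
    unfolding homotopy_class_def by (blast intro: equivclp_trans equivclp_sym)
qed

lemma homotopic_Cons:
  assumes "equivclp (insert_point E) c c'"
  shows "hd c' = hd c" and "(x, hd c) \<in> E \<Longrightarrow> equivclp (insert_point E) (x # c) (x # c')"
proof -
  have insert_Cons: "insert_point E (x # a) (x # b)" if "insert_point E a b" "(x, hd a) \<in> E" for a b
  proof -
    obtain us y vs where split: "a = us @ vs" "b = us @ y # vs"
      using \<open>insert_point E a b\<close> unfolding insert_point_def by blast
    obtain p q where "echain E p q a" "echain E p q b"
      using \<open>insert_point E a b\<close> unfolding insert_point_def by blast
    then have "echain E x q (x # a)" "echain E x q (x # b)"
      using that(2) by (auto simp: echain_def successively_Cons)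
    moreover have "x # a = (x # us) @ vs" "x # b = (x # us) @ y # vs"
      using split by simp_all
    ultimately show ?thesis unfolding insert_point_def by blast
  qed
  have hd: "hd b = hd a" if "insert_point E a b" for a b
    using that by (auto simp: insert_point_def echain_def)
  have "hd c' = hd c \<and> ((x, hd c) \<in> E \<longrightarrow> equivclp (insert_point E) (x # c) (x # c'))"
    using assms
  proof (induction rule: equivclp_induct)
    case base
    then show ?case by simp
  next
    case (step b d)
    then show ?case
      by (metis hd insert_Cons equivclp_into_equivclp)
  qed
  then show "hd c' = hd c" and "(x, hd c) \<in> E \<Longrightarrow> equivclp (insert_point E) (x # c) (x # c')"
    by blast+
qed

text \<open>Inserting a point \<open>z\<close> between two consecutive points \<open>x\<close>, \<open>y\<close> of an \<open>E\<close>-chain is an elementary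
  \<open>E\<close>-homotopy as soon as both new steps are in \<open>E\<close>. Doing this at every step of the chain, with
  \<open>z\<close> \<open>D\<close>-close to \<open>x\<close> and \<open>y\<close>, refines the chain without changing its \<open>E\<close>-class.\<close>

lemma echain_homotopic_finer:
  assumes "D \<subseteq> E" and mid: "\<And>x y. (x, y) \<in> E \<Longrightarrow> \<exists>z. (x, z) \<in> D \<and> (z, y) \<in> D"
    and "echain E p q c"
  shows "\<exists>c'. echain D p q c' \<and> equivclp (insert_point E) c c'"
  using assms(3)
proof (induction c arbitrary: p rule: induct_list012)
  case 1
  then show ?case by (simp add: echain_def)
next
  case (2 x)
  then have "echain D p q [x]" by (auto simp: echain_def)
  then show ?case by (blast intro: equivclp_refl)
next
  case (3 x y c)
  then have p: "p = x" and xy: "(x, y) \<in> E" and tail: "echain E y q (y # c)"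
    by (auto simp: echain_def)
  obtain c' where c': "echain D y q c'" and hom: "equivclp (insert_point E) (y # c) c'"
    using "3.IH"(2)[OF tail] by blast
  obtain z where z: "(x, z) \<in> D" "(z, y) \<in> D" using mid[OF xy] by blast
  have "echain E x q (x # z # y # c)"
    using tail z \<open>D \<subseteq> E\<close> by (auto simp: echain_def)
  moreover have "x # y # c = [x] @ y # c" "x # z # y # c = [x] @ z # y # c" by simp_all
  ultimately have "insert_point E (x # y # c) (x # z # y # c)"
    using "3.prems" p unfolding insert_point_def by blast
  moreover have "equivclp (insert_point E) (x # z # y # c) (x # z # c')"
    using z \<open>D \<subseteq> E\<close> by (intro homotopic_Cons(2) hom) auto
  ultimately have "equivclp (insert_point E) (x # y # c) (x # z # c')"
    by (metis equivclp_trans r_into_equivclp)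
  moreover have "echain D x q (x # z # c')"
    using z c' by (auto simp: echain_def successively_Cons)
  ultimately show ?case using p by blast
qed


section \<open>The maps between chain spaces\<close>

lemma chain_map_in_chain_space:
  assumes "C \<in> chain_space pt D" "D \<subseteq> E"
  shows "chain_map E C \<in> chain_space pt E"
  using assms chain_map_homotopy_class[OF assms(2)] echain_mono[OF _ assms(2)]
  unfolding chain_space_def by fastforce

lemma chain_map_self: "C \<in> chain_space pt E \<Longrightarrow> chain_map E C = C"
  by (auto simp: chain_space_def chain_map_homotopy_class)

lemma chain_map_chain_map:
  assumes "C \<in> chain_space pt F" "F \<subseteq> D" "D \<subseteq> E"
  shows "chain_map E (chain_map D C) = chain_map E C"
  using assms by (auto simp: chain_space_def chain_map_homotopy_class)

lemma chain_map_surj: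
  assumes "D \<subseteq> E" "\<And>x y. (x, y) \<in> E \<Longrightarrow> \<exists>z. (x, z) \<in> D \<and> (z, y) \<in> D"
    and "C \<in> chain_space pt E"
  shows "\<exists>C'\<in>chain_space pt D. chain_map E C' = C"
proof -
  obtain c q where C: "C = homotopy_class E c" and c: "echain E pt q c"
    using assms(3) unfolding chain_space_def by blast
  obtain c' where c': "echain D pt q c'" "equivclp (insert_point E) c c'"
    using echain_homotopic_finer[OF assms(1,2) c] by blast
  have "chain_map E (homotopy_class D c') = C"
    using c'(2) by (simp add: C chain_map_homotopy_class[OF assms(1)] flip: homotopy_class_eq_iff)
  then show ?thesis using c'(1) unfolding chain_space_def by blast
qed

text \<open>A pair in a star entourage is witnessed by two chains with a common initial part. Reading the
  same two chains as \<open>E\<close>-chains shows that the star of \<open>F \<inter> D\<close> in \<open>X\<^sub>D\<close> is mapped into the star of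
  \<open>F\<close> in \<open>X\<^sub>E\<close>.\<close>

lemma chain_map_uniformly_continuous:
  assumes "entourage D" "entourage E" "D \<subseteq> E"
  shows "filterlim (map_prod (chain_map E) (chain_map E))
    (chain_uniformity pt E) (chain_uniformity pt D)"
  unfolding filterlim_iff eventually_chain_uniformity[OF assms(1)]
    eventually_chain_uniformity[OF assms(2)]
proof safe
  fix P F
  assume F: "entourage F" "F \<subseteq> E" "\<forall>p\<in>star_entourage pt E F. P p"
  have "map_prod (chain_map E) (chain_map E) p \<in> star_entourage pt E F"
    if p: "p \<in> star_entourage pt D (F \<inter> D)" for p
  proof -
    obtain xs y z where "p = (homotopy_class D (xs @ [y]), homotopy_class D (xs @ [z]))"
      "xs \<noteq> []" "echain D pt y (xs @ [y])" "echain D pt z (xs @ [z])" "(y, z) \<in> F"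
      using p unfolding star_entourage_def by blast
    then show ?thesis
      using echain_mono[OF _ assms(3)] chain_map_homotopy_class[OF assms(3)]
      unfolding star_entourage_def map_prod_def by (simp only: mem_Collect_eq prod.case) blast
  qed
  moreover have "entourage (F \<inter> D)"
    using F(1) assms(1) by (auto simp: entourage_def eventually_conj_iff sym_Int)
  ultimately show "\<exists>F. entourage F \<and> F \<subseteq> D \<and>
      (\<forall>p\<in>star_entourage pt D F. P (map_prod (chain_map E) (chain_map E) p))"
    using F(3) by (intro exI[of _ "F \<inter> D"]) auto
qed


section \<open>Limits along a decreasing sequence of entourages\<close>

lemma limit_spaceD:
  assumes "f \<in> limit_space pt" "entourage E"
  shows "f E \<in> chain_space pt E" and "entourage D \<Longrightarrow> D \<subseteq> E \<Longrightarrow> chain_map E (f D) = f E"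
  using assms by (auto simp: limit_space_def inverse_limit_def)

locale entourage_sequence =
  fixes A :: "nat \<Rightarrow> ('a::uniform_space \<times> 'a) set"
  assumes entourage_A: "entourage (A i)"
    and decseq_A: "decseq A"
    and base_A: "entourage E \<Longrightarrow> \<exists>i. A i \<subseteq> E"
begin

definition seq_limit :: "'a \<Rightarrow> (nat \<Rightarrow> 'a list set) set" where
  "seq_limit pt = inverse_limit UNIV (\<le>) (\<lambda>i. chain_space pt (A i)) (\<lambda>i j. chain_map (A i))"

lemma A_mono: "i \<le> j \<Longrightarrow> A j \<subseteq> A i"
  using decseq_A by (simp add: decseq_def)

lemma seq_limitD:
  assumes "s \<in> seq_limit pt"
  shows "s i \<in> chain_space pt (A i)" and "i \<le> j \<Longrightarrow> chain_map (A i) (s j) = s i"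
  using assms by (auto simp: seq_limit_def inverse_limit_def)

definition index :: "('a \<times> 'a) set \<Rightarrow> nat" where
  "index E = (SOME i. A i \<subseteq> E)"

lemma A_index: "entourage E \<Longrightarrow> A (index E) \<subseteq> E"
  unfolding index_def using base_A by (rule someI_ex)

text \<open>The class that a thread of the sequence induces in \<open>X\<^sub>E\<close> does not depend on the term
  it is read off from. Hence each thread of the sequence extends to all entourages.\<close>

lemma chain_map_seq_limit_eq:
  assumes s: "s \<in> seq_limit pt" and "A i \<subseteq> E" "A j \<subseteq> E"
  shows "chain_map E (s i) = chain_map E (s j)"
proof -
  have "chain_map E (s i) = chain_map E (s j)" if "i \<le> j" "A i \<subseteq> E" for i j
    using chain_map_chain_map[OF seq_limitD(1)[OF s] A_mono[OF that(1)] that(2)]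
      seq_limitD(2)[OF s that(1)] by simp
  then show ?thesis using assms by (metis nle_le)
qed

definition extend :: "(nat \<Rightarrow> 'a list set) \<Rightarrow> ('a \<times> 'a) set \<Rightarrow> 'a list set" where
  "extend s = (\<lambda>E\<in>{E. entourage E}. chain_map E (s (index E)))"

lemma extend_eq:
  assumes "s \<in> seq_limit pt" "entourage E" "A i \<subseteq> E"
  shows "extend s E = chain_map E (s i)"
  using chain_map_seq_limit_eq[OF assms(1) A_index[OF assms(2)] assms(3)] assms(2)
  by (simp add: extend_def)

lemma extend_in_limit_space:
  assumes s: "s \<in> seq_limit pt"
  shows "extend s \<in> limit_space pt"
  unfolding limit_space_def inverse_limit_def
proof (intro CollectI conjI PiE_I ballI impI)
  fix E :: "('a \<times> 'a) set" assume "E \<in> {E. entourage E}"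
  then show "extend s E \<in> chain_space pt E"
    using chain_map_in_chain_space[OF seq_limitD(1)[OF s] A_index] by (simp add: extend_def)
next
  fix E :: "('a \<times> 'a) set" assume "E \<notin> {E. entourage E}"
  then show "extend s E = undefined" by (simp add: extend_def)
next
  fix D E :: "('a \<times> 'a) set" assume "E \<in> {E. entourage E}" "D \<in> {E. entourage E}" and "D \<subseteq> E"
  then have D: "entourage D" and E: "entourage E" by simp_all
  have "A (index D) \<subseteq> E" using A_index[OF D] \<open>D \<subseteq> E\<close> by blast
  then show "chain_map E (extend s D) = extend s E"
    using chain_map_chain_map[OF seq_limitD(1)[OF s] A_index[OF D] \<open>D \<subseteq> E\<close>]
      extend_eq[OF s D A_index[OF D]] extend_eq[OF s E] by simp
qed

lemma extend_A:
  assumes s: "s \<in> seq_limit pt"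
  shows "extend s (A i) = s i"
  using extend_eq[OF s entourage_A order_refl] chain_map_self[OF seq_limitD(1)[OF s]] by simp

lemma restriction_in_seq_limit:
  assumes "f \<in> limit_space pt"
  shows "(\<lambda>i. f (A i)) \<in> seq_limit pt"
  using limit_spaceD[OF assms entourage_A] entourage_A A_mono
  by (auto simp: seq_limit_def inverse_limit_def)

lemma extend_restriction:
  assumes f: "f \<in> limit_space pt"
  shows "extend (\<lambda>i. f (A i)) = f"
proof
  fix E
  show "extend (\<lambda>i. f (A i)) E = f E"
  proof (cases "entourage E")
    case True
    then show ?thesis
      using limit_spaceD(2)[OF f True entourage_A A_index[OF True]] by (simp add: extend_def)
  next
    case False
    then show ?thesis using f by (auto simp: extend_def limit_space_def inverse_limit_def)
  qed
qed

lemma bij_betw_restriction: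
  "bij_betw (\<lambda>f i. f (A i)) (limit_space pt) (seq_limit pt)"
  by (rule bij_betw_byWitness[where f' = extend])
     (auto simp: extend_restriction extend_A restriction_in_seq_limit extend_in_limit_space)

text \<open>Both directions are continuous coordinatewise: a coordinate of the restriction is a coordinate
  of the given thread, and the coordinate of the extension at \<open>E\<close> is the image of a single
  coordinate under a bonding map.\<close>

theorem uniform_homeomorphism_restriction:
  "uniform_homeomorphism (limit_space pt) (limit_uniformity pt) (seq_limit pt)
     (inverse_limit_uniformity UNIV (seq_limit pt) (\<lambda>i. chain_uniformity pt (A i)))
     (\<lambda>f i. f (A i))"
  (is "uniform_homeomorphism ?L ?U ?S ?V ?r")
proof -
  let ?inv = "inv_into ?L ?r"
  have inv: "?inv s = extend s" if "s \<in> ?S" for s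
    using that bij_betw_restriction[of pt]
    by (metis bij_betw_imp_inj_on extend_A extend_in_limit_space ext inv_into_f_eq)
  have V_S: "\<forall>\<^sub>F p in ?V. p \<in> ?S \<times> ?S"
    unfolding inverse_limit_uniformity_def
    by (rule filter_leD[OF inf.cobounded1]) (simp add: eventually_principal)
  have U_L: "\<forall>\<^sub>F p in ?U. p \<in> ?L \<times> ?L"
    unfolding limit_uniformity_def inverse_limit_uniformity_def
    by (rule filter_leD[OF inf.cobounded1]) (simp add: eventually_principal)
  have U_eval: "filterlim (\<lambda>(f, g). (f E, g E)) (chain_uniformity pt E) ?U" if "entourage E" for E
    unfolding limit_uniformity_def inverse_limit_uniformity_def
    by (rule filterlim_mono[OF filterlim_filtercomap order_refl])
       (use that in \<open>auto intro: le_infI2 INF_lower\<close>)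
  have V_eval: "filterlim (\<lambda>(s, t). (s i, t i)) (chain_uniformity pt (A i)) ?V" for i
    unfolding inverse_limit_uniformity_def
    by (rule filterlim_mono[OF filterlim_filtercomap order_refl])
       (auto intro: le_infI2 INF_lower)
  have "filterlim (map_prod ?r ?r) ?V ?U"
    unfolding inverse_limit_uniformity_def[of UNIV] filterlim_inf filterlim_principal
      filterlim_INF filterlim_filtercomap_iff
  proof (intro conjI ballI)
    show "\<forall>\<^sub>F p in ?U. map_prod ?r ?r p \<in> ?S \<times> ?S"
      using U_L by eventually_elim (auto intro: restriction_in_seq_limit)
    show "filterlim ((\<lambda>(f, g). (f i, g i)) \<circ> map_prod ?r ?r) (chain_uniformity pt (A i)) ?U" for i
      using U_eval[OF entourage_A] by (simp add: o_def case_prod_unfold)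
  qed
  moreover have "filterlim (map_prod ?inv ?inv) ?U ?V"
    unfolding limit_uniformity_def inverse_limit_uniformity_def[of "{E. entourage E}"]
      filterlim_inf filterlim_principal filterlim_INF filterlim_filtercomap_iff
  proof (intro conjI ballI)
    show "\<forall>\<^sub>F p in ?V. map_prod ?inv ?inv p \<in> ?L \<times> ?L"
      using V_S by eventually_elim (auto simp: inv intro: extend_in_limit_space)
    fix E :: "('a \<times> 'a) set" assume "E \<in> {E. entourage E}"
    then have E: "entourage E" by simp
    have "filterlim (\<lambda>p. map_prod (chain_map E) (chain_map E)
        ((\<lambda>(s, t). (s (index E), t (index E))) p)) (chain_uniformity pt E) ?V"
      by (rule filterlim_compose[OF
            chain_map_uniformly_continuous[OF entourage_A E A_index[OF E]] V_eval])
    moreover have "\<forall>\<^sub>F p in ?V. map_prod (chain_map E) (chain_map E)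
        ((\<lambda>(s, t). (s (index E), t (index E))) p) = ((\<lambda>(f, g). (f E, g E)) \<circ> map_prod ?inv ?inv) p"
      using V_S by eventually_elim (use E in \<open>auto simp: inv extend_def\<close>)
    ultimately show "filterlim ((\<lambda>(f, g). (f E, g E)) \<circ> map_prod ?inv ?inv)
        (chain_uniformity pt E) ?V"
      by (rule filterlim_cong[THEN iffD1, OF refl refl, rotated])
  qed
  ultimately show ?thesis
    unfolding uniform_homeomorphism_def using bij_betw_restriction by blast
qed

text \<open>The midpoint hypothesis makes the bonding maps of the sequence surjective, so \<open>C\<close> can be lifted
  one step at a time to a thread of the sequence, and this thread extends to all entourages.\<close>

lemma limit_space_eval_surj:
  assumes mid: "\<And>i x y. (x, y) \<in> A i \<Longrightarrow> \<exists>z. (x, z) \<in> A (Suc i) \<and> (z, y) \<in> A (Suc i)"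
    and C: "C \<in> chain_space pt (A 0)"
  shows "\<exists>f\<in>limit_space pt. f (A 0) = C"
proof -
  have "\<exists>s. \<forall>i. (s i \<in> chain_space pt (A i) \<and> (i = 0 \<longrightarrow> s i = C)) \<and>
      chain_map (A i) (s (Suc i)) = s i"
  \<comment> \<open>The clause for \<open>i = 0\<close> makes the choice start at \<open>C\<close>.\<close>
  proof (rule dependent_nat_choice)
    show "\<exists>x. x \<in> chain_space pt (A 0) \<and> (0 = 0 \<longrightarrow> x = C)" using C by blast
  next
    fix x n assume "x \<in> chain_space pt (A n) \<and> (n = 0 \<longrightarrow> x = C)"
    then show "\<exists>y. (y \<in> chain_space pt (A (Suc n)) \<and> (Suc n = 0 \<longrightarrow> y = C)) \<and> chain_map (A n) y = x"
      using chain_map_surj[OF A_mono[of n "Suc n"] mid, of x pt] by auto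
  qed
  then obtain s where mem: "\<And>i. s i \<in> chain_space pt (A i)" and "s 0 = C"
    and bond: "\<And>i. chain_map (A i) (s (Suc i)) = s i" by blast
  have "chain_map (A i) (s j) = s i" if "i \<le> j" for i j
    using that
  proof (induction j rule: dec_induct)
    case base
    show ?case using chain_map_self[OF mem] .
  next
    case (step j)
    have "chain_map (A i) (s (Suc j)) = chain_map (A i) (chain_map (A j) (s (Suc j)))"
      using chain_map_chain_map[OF mem A_mono A_mono] step.hyps by simp
    then show ?case using bond step.IH by simp
  qed
  then have s: "s \<in> seq_limit pt"
    using mem by (auto simp: seq_limit_def inverse_limit_def)
  then show ?thesis
    using extend_in_limit_space[OF s] extend_A[OF s, of 0] \<open>s 0 = C\<close> by blast
qed

end


section \<open>Inner metric spaces\<close>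

lemma entourage_metric_entourage: "e > 0 \<Longrightarrow> entourage (metric_entourage e)"
  by (auto simp: entourage_def metric_entourage_def eventually_uniformity_metric sym_def
        dist_commute)

lemma entourage_metric_sequence:
  fixes e :: "nat \<Rightarrow> real"
  assumes "\<And>i. 0 < e i" "decseq e" "e \<longlonglongrightarrow> 0"
  shows "entourage_sequence (\<lambda>i. metric_entourage (e i) :: ('a::metric_space \<times> 'a) set)"
proof
  show "entourage (metric_entourage (e i) :: ('a \<times> 'a) set)" for i
    using assms(1) by (rule entourage_metric_entourage)
  show "decseq (\<lambda>i. metric_entourage (e i) :: ('a \<times> 'a) set)"
    using assms(2) by (fastforce simp: decseq_def metric_entourage_def)
  fix E :: "('a \<times> 'a) set" assume "entourage E"
  then obtain r where r: "r > 0" "\<And>x y. dist x y < r \<Longrightarrow> (x, y) \<in> E"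
    unfolding entourage_def eventually_uniformity_metric by blast
  obtain i where "e i < r"
    using order_tendstoD(2)[OF assms(3) r(1)] unfolding eventually_sequentially by blast
  then have "metric_entourage (e i) \<subseteq> E"
    using r(2) by (fastforce simp: metric_entourage_def)
  then show "\<exists>i. metric_entourage (e i) \<subseteq> E" ..
qed

lemma dist_via_le_curve_length:
  assumes "0 \<le> t" "t \<le> 1"
  shows "ennreal (dist (g 0) (g t) + dist (g t) (g 1)) \<le> curve_length g"
proof -
  define u :: "nat \<Rightarrow> real" where "u i = (if i = 0 then 0 else if i = 1 then t else 1)" for i
  have "mono_on {..2} u"
    using assms by (auto simp: mono_on_def u_def)
  then have "(\<Sum>i<2. ennreal (dist (g (u i)) (g (u (Suc i))))) \<le> curve_length g"
    unfolding curve_length_def by (intro SUP_upper2[of "(2, u)"]) (auto simp: u_def)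
  then show ?thesis by (simp add: numeral_2_eq_2 u_def)
qed

text \<open>On a curve from \<open>x\<close> to \<open>y\<close> of length less than \<open>e\<close> there is a point equidistant from \<open>x\<close> and
  \<open>y\<close>, by the intermediate value theorem; the two distances add up to at most the length.\<close>

lemma inner_metric_space_midpoint:
  fixes x y :: "'a::metric_space"
  assumes "inner_metric_space TYPE('a)" "dist x y < e"
  shows "\<exists>z. dist x z < e / 2 \<and> dist z y < e / 2"
proof -
  have "0 < e" using assms(2) by (meson le_less_trans zero_le_dist)
  then have "ennreal (dist x y) < ennreal e" using assms(2) by (simp add: ennreal_less_iff)
  then have "(INF g \<in> {g. path g \<and> pathstart g = x \<and> pathfinish g = y}. curve_length g) < ennreal e"
    using assms(1) unfolding inner_metric_space_def by simp
  then obtain g where g: "path g" "g 0 = x" "g 1 = y" and len: "curve_length g < ennreal e"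
    by (auto simp: INF_less_iff pathstart_def pathfinish_def)
  have "continuous_on {0..1} (\<lambda>t. dist x (g t) - dist (g t) y)"
    using g(1) unfolding path_def by (intro continuous_intros)
  then obtain t where t: "0 \<le> t" "t \<le> 1" "dist x (g t) - dist (g t) y = 0"
    using IVT'[of "\<lambda>t. dist x (g t) - dist (g t) y" 0 0 1] g by auto
  have "ennreal (dist x (g t) + dist (g t) y) < ennreal e"
    using dist_via_le_curve_length[OF t(1,2), of g] len unfolding g(2,3)
    by (rule order_le_less_trans)
  then have "dist x (g t) + dist (g t) y < e"
    by (simp add: ennreal_less_iff del: ennreal_plus)
  then show ?thesis using t(3) by (intro exI[of _ "g t"]) auto
qed

lemma limit_space_eval_metric_entourage_surj:
  fixes pt :: "'a::metric_space"
  assumes inner: "inner_metric_space TYPE('a)" and "e > 0"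
    and C: "C \<in> chain_space pt (metric_entourage e)"
  shows "\<exists>f\<in>limit_space pt. f (metric_entourage e) = C"
proof -
  define a where "a i = e / 2 ^ i" for i :: nat
  have "decseq a"
    using \<open>e > 0\<close> by (auto simp: a_def decseq_def intro!: divide_left_mono power_increasing)
  moreover have "a \<longlonglongrightarrow> 0"
    unfolding a_def by (rule LIMSEQ_divide_realpow_zero) simp
  moreover have "0 < a i" for i
    using \<open>e > 0\<close> by (simp add: a_def)
  ultimately interpret entourage_sequence "\<lambda>i. metric_entourage (a i) :: ('a \<times> 'a) set"
    by (intro entourage_metric_sequence)
  have half: "a (Suc i) = a i / 2" for i
    by (simp add: a_def)
  have "\<exists>z. (x, z) \<in> metric_entourage (a (Suc i)) \<and> (z, y) \<in> metric_entourage (a (Suc i))"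
    if "(x, y) \<in> metric_entourage (a i)" for i and x y :: 'a
    using inner_metric_space_midpoint[OF inner, of x y "a i"] that
    by (simp add: metric_entourage_def half)
  then show ?thesis
    using limit_space_eval_surj[of C pt] C by (simp add: a_def)
qed

lemma echain_metric_entourage:
  assumes "echain UNIV p q c"
  shows "\<exists>e>0. echain (metric_entourage e) p q c"
proof -
  define e where "e = 1 + diameter (set c)"
  have "bounded (set c)" by (simp add: finite_imp_bounded)
  then have "(x, y) \<in> metric_entourage e" if "x \<in> set c" "y \<in> set c" for x y
    using diameter_bounded_bound[OF _ that] by (auto simp: metric_entourage_def e_def)
  moreover have "e > 0"
    using diameter_ge_0[OF \<open>bounded (set c)\<close>] by (simp add: e_def)
  ultimately show ?thesis
    using assms by (auto simp: echain_def intro: successively_mono)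
qed

lemma inner_metric_space_coverable:
  fixes pt :: "'a::metric_space"
  assumes inner: "inner_metric_space TYPE('a)"
  shows "coverable pt"
  unfolding coverable_def
proof (intro exI[of _ "insert UNIV (metric_entourage ` {0<..})"] conjI ballI allI impI)
  fix E :: "('a \<times> 'a) set" assume E: "E \<in> insert UNIV (metric_entourage ` {0<..})"
  then show ent: "entourage E"
    by (auto intro: entourage_metric_entourage) (simp add: entourage_def sym_def)
  have "\<exists>f\<in>limit_space pt. f E = C" if C: "C \<in> chain_space pt E" for C
  proof (cases "E = UNIV")
    case False
    then show ?thesis
      using E C limit_space_eval_metric_entourage_surj[OF inner] by auto
  next
    case True
    then obtain c q e where c: "C = homotopy_class UNIV c" "echain (metric_entourage e) pt q c"
      and "e > 0"
      using C echain_metric_entourage unfolding chain_space_def by blast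
    then obtain f where f: "f \<in> limit_space pt"
      and "f (metric_entourage e) = homotopy_class (metric_entourage e) c"
      using limit_space_eval_metric_entourage_surj[OF inner \<open>e > 0\<close>]
      unfolding chain_space_def by blast
    moreover have "f UNIV = chain_map UNIV (f (metric_entourage e))"
      using ent unfolding True
      by (intro limit_spaceD(2)[OF f, symmetric] entourage_metric_entourage \<open>e > 0\<close> subset_UNIV)
    ultimately show ?thesis
      using True c(1) by (auto simp: chain_map_homotopy_class)
  qed
  moreover have "f E \<in> chain_space pt E" if "f \<in> limit_space pt" for f
    using that ent by (rule limit_spaceD(1))
  ultimately show "(\<lambda>f. f E) ` limit_space pt = chain_space pt E" by blast
next
  fix F :: "('a \<times> 'a) set" assume "\<forall>\<^sub>F p in uniformity. p \<in> F"
  then obtain e where "e > 0" "\<And>x y. dist x y < e \<Longrightarrow> (x, y) \<in> F"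
    unfolding eventually_uniformity_metric by blast
  then show "\<exists>E\<in>insert UNIV (metric_entourage ` {0<..}). E \<subseteq> F"
    by (intro bexI[of _ "metric_entourage e"]) (auto simp: metric_entourage_def)
qed simp

theorem corollary99:
  fixes pt :: "'a::metric_space"
  assumes "inner_metric_space TYPE('a)"
  shows "coverable pt \<and>
    (\<forall>\<epsilon> :: nat \<Rightarrow> real.
       (\<forall>i. 0 < \<epsilon> i) \<and> decseq \<epsilon> \<and> \<epsilon> \<longlonglongrightarrow> 0 \<longrightarrow>
       uniform_homeomorphism
         (limit_space pt) (limit_uniformity pt)
         (seq_limit_space pt \<epsilon>) (seq_limit_uniformity pt \<epsilon>)
         (\<lambda>f i. f (metric_entourage (\<epsilon> i))))"
proof (intro conjI allI impI)
  show "coverable pt" using assms by (rule inner_metric_space_coverable)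
next
  fix \<epsilon> :: "nat \<Rightarrow> real"
  assume \<epsilon>: "(\<forall>i. 0 < \<epsilon> i) \<and> decseq \<epsilon> \<and> \<epsilon> \<longlonglongrightarrow> 0"
  then interpret entourage_sequence "\<lambda>i. metric_entourage (\<epsilon> i) :: ('a \<times> 'a) set"
    by (intro entourage_metric_sequence) auto
  show "uniform_homeomorphism
      (limit_space pt) (limit_uniformity pt)
      (seq_limit_space pt \<epsilon>) (seq_limit_uniformity pt \<epsilon>)
      (\<lambda>f i. f (metric_entourage (\<epsilon> i)))"
    using uniform_homeomorphism_restriction[of pt]
    by (simp add: seq_limit_uniformity_def seq_limit_space_def seq_limit_def)
qed

end
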